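(* Let $m\ge1$ and let $x,y$ be nonnegative integers with $my<x$. Then the Zeta polynomial of the poset $\mathscr{P}^F_{m,x,y}$ is $$Z^F_{m,x,y}(u)=\frac{(x-my-1)(u-1)+1}{y!}\prod_{j=2}^{y}\bigl((x-1)(u-1)+j\bigr),$$ with the convention that a product $\prod_{j=2}^{y}\alpha_j$ equals $1$ when $y=1$ and equals $1/\alpha_1$ when $y=0$.
   Context: For integers $m\ge1$ and $x,y\ge0$ with $my<x$, $\mathscr{P}^F_{m,x,y}$ is the set of words $(a_1,\dots,a_{x-1})$ of nonnegative integers such that $m\sum_{i\le j}a_i<j$ for all $1\le j\le x-1$ and $\sum_ia_i\le y$, partially ordered term-wise (equivalently, lattice paths with unit steps east and north from $(0,0)$ to $(x,y)$ staying strictly below the line $my=x$ except at the origin, where $a_i$ is the number of north steps between the $i$-th and $(i+1)$-th east steps). The Zeta polynomial of a finite poset $P$ is the polynomial $Z(u)$ such that for every integer $q\ge2$, $Z(q)$ is the number of multichains $e_1\le e_2\le\cdots\le e_{q-1}$ in $P$. *)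

theory Defs
  imports "HOL-Computational_Algebra.Computational_Algebra"
begin

text \<open>A poset is a carrier set together with its order relation, as in \<^const>\<open>partial_order_on\<close>.
  For a transitive relation, \<^const>\<open>sorted_wrt\<close> says that consecutive entries are related.\<close>

definition multichains :: "'a set \<Rightarrow> 'a rel \<Rightarrow> nat \<Rightarrow> 'a list set" where
  "multichains P r n = {es. length es = n \<and> set es \<subseteq> P \<and> sorted_wrt (\<lambda>e e'. (e, e') \<in> r) es}"

definition is_zeta_polynomial :: "'a set \<Rightarrow> 'a rel \<Rightarrow> rat poly \<Rightarrow> bool" where
  "is_zeta_polynomial P r Z \<longleftrightarrow>
     (\<forall>q::nat. q \<ge> 2 \<longrightarrow> poly Z (of_nat q) = of_nat (card (multichains P r (q - 1))))"

lemma is_zeta_polynomial_unique: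
  assumes "is_zeta_polynomial P r Z" "is_zeta_polynomial P r Z'"
  shows "Z = Z'"
proof (rule ccontr)
  assume "Z \<noteq> Z'"
  then have "finite {x. poly (Z - Z') x = 0}"
    by (intro poly_roots_finite) simp
  moreover have "of_nat ` {2..} \<subseteq> {x. poly (Z - Z') x = 0}"
    using assms by (auto simp: is_zeta_polynomial_def)
  ultimately have "finite (of_nat ` {2..} :: rat set)"
    by (rule finite_subset[rotated])
  then have "finite {2::nat..}"
    by (rule finite_imageD) (simp add: inj_on_def)
  then show False
    using infinite_Ici by blast
qed

lemma finite_multichains:
  assumes "finite P"
  shows "finite (multichains P r n)"
  using finite_lists_length_eq[OF assms, of n]
  by (rule finite_subset[rotated]) (auto simp: multichains_def)

text \<open>The word \<open>(a\<^sub>1, \<dots>, a\<^sub>x\<^sub>-\<^sub>1)\<close> is a list \<open>a\<close> of length \<open>x - 1\<close>,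
  so that \<open>a\<^sub>1 + \<dots> + a\<^sub>j\<close> is \<open>sum_list (take j a)\<close>.\<close>

definition PF :: "nat \<Rightarrow> nat \<Rightarrow> nat \<Rightarrow> nat list set" where
  "PF m x y = {a. length a = x - 1 \<and> (\<forall>j\<in>{1..x - 1}. m * sum_list (take j a) < j) \<and> sum_list a \<le> y}"

definition PF_le :: "nat \<Rightarrow> nat \<Rightarrow> nat \<Rightarrow> nat list rel" where
  "PF_le m x y = {(a, b). a \<in> PF m x y \<and> b \<in> PF m x y \<and> list_all2 (\<le>) a b}"

lemma finite_PF: "finite (PF m x y)"
proof -
  have "PF m x y \<subseteq> {a. set a \<subseteq> {..y} \<and> length a = x - 1}"
    using member_le_sum_list by (fastforce simp: PF_def)
  then show ?thesis
    by (rule finite_subset) (simp add: finite_lists_length_eq)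
qed

lemma partial_order_PF: "partial_order_on (PF m x y) (PF_le m x y)"
proof -
  have "refl_on (PF m x y) (PF_le m x y)"
    by (auto simp: refl_on_def PF_le_def list_all2_refl)
  moreover have "trans (PF_le m x y)"
    by (auto simp: trans_def PF_le_def intro: list_all2_trans[of "(\<le>)" "(\<le>)" "(\<le>)"])
  moreover have "antisym (PF_le m x y)"
    by (auto simp: antisym_def PF_le_def intro: list_all2_antisym[of "(\<le>)" "(\<le>)"])
  moreover have "PF_le m x y \<subseteq> PF m x y \<times> PF m x y"
    by (auto simp: PF_le_def)
  ultimately show ?thesis
    by (simp add: partial_order_on_def preorder_on_def)
qed

definition prod_from_2 :: "nat \<Rightarrow> (nat \<Rightarrow> 'a) \<Rightarrow> 'a::field" where
  "prod_from_2 y \<alpha> = (if y = 0 then 1 / \<alpha> 1 else \<Prod>j = 2..y. \<alpha> j)"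

text \<open>The formula is read in the field of rational functions, with \<open>u\<close> the indeterminate:
  for \<open>y = 0\<close> it divides by \<open>(x - 1) (u - 1) + 1\<close>, a non-zero polynomial that may vanish
  at some rational \<open>u\<close>.\<close>

definition indet :: "rat poly fract" where
  "indet = to_fract [:0, 1:]"

definition ZF :: "nat \<Rightarrow> nat \<Rightarrow> nat \<Rightarrow> rat poly fract" where
  "ZF m x y =
     (let u = indet in
        ((of_nat x - of_nat m * of_nat y - 1) * (u - 1) + 1) / fact y
        * prod_from_2 y (\<lambda>j. (of_nat x - 1) * (u - 1) + of_nat j))"

end

theory Submission
  imports Defs
begin

text \<open>A multichain of length \<open>n\<close> with top element \<open>a\<close> splits letter by letter into weakly
  increasing sequences of length \<open>n\<close> ending in \<open>a\<^sub>i\<close>, which are counted by the coefficient of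
  \<open>t\<close> to the power \<open>a\<^sub>i\<close> in \<open>A = (1 - t)\<^sup>-\<^sup>n\<close>. So multichains are counted by the words below the line,
  each letter \<open>k\<close> weighted by the \<open>k\<close>-th coefficient of \<open>A\<close>. For every power series \<open>A\<close> with
  constant term 1, the weighted words of length \<open>N + 1\<close> and letter sum \<open>s\<close> with \<open>m s \<le> N + 1\<close> are
  counted by the \<open>s\<close>-th coefficient of \<open>A\<^sup>N (A - m t A')\<close>. Dividing by \<open>1 - t\<close> sums over \<open>s \<le> y\<close>,
  and for the above \<open>A\<close> gives a combination of two binomial coefficients.\<close>

section \<open>Coefficients of powers of the geometric series\<close>

definition geometric_fps :: "rat fps" where
  "geometric_fps = Abs_fps (\<lambda>_. 1)"

lemma geometric_fps_nth [simp]: "geometric_fps $ n = 1"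
  by (simp add: geometric_fps_def)

lemma geometric_fps_times_nth: "(geometric_fps * f) $ n = (\<Sum>i\<le>n. f $ i)"
  by (subst mult.commute) (simp add: fps_mult_nth atLeast0AtMost)

lemma geometric_fps_power_0 [simp]: "(geometric_fps ^ n) $ 0 = 1"
  by (simp add: fps_power_zeroth)

lemma inverse_one_minus_fps_X: "inverse (1 - fps_X) = geometric_fps"
  using fps_inverse_gp'[where ?'a = rat] fps_inverse_idempotent[of geometric_fps]
  by (simp add: geometric_fps_def)

lemma geometric_fps_power_nth: "(geometric_fps ^ Suc n) $ k = of_nat ((n + k) choose k)"
  using one_minus_const_fps_X_neg_power'[of "Suc n" "1 :: rat"]
  by (simp add: fps_inverse_power inverse_one_minus_fps_X del: power_Suc)

lemma fps_deriv_geometric: "fps_deriv geometric_fps = geometric_fps ^ 2"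
proof (rule fps_ext)
  fix n
  show "fps_deriv geometric_fps $ n = (geometric_fps ^ 2) $ n"
    by (simp add: power2_eq_square geometric_fps_times_nth)
qed

section \<open>Chains under a fixed word, counted letter by letter\<close>

lemma lists_below_Cons:
  "{b. list_all2 (\<le>) b (x # a)} = (\<lambda>(j, b). j # b) ` ({..x} \<times> {b. list_all2 (\<le>) b a})"
  for x :: nat
  by (auto simp: list_all2_Cons2 image_iff)

lemma finite_lists_below: "finite {b. list_all2 (\<le>) b a}" for a :: "nat list"
  by (induction a) (simp_all add: lists_below_Cons)

text \<open>The lists below \<open>a\<close> form a product of independent ranges, so distributivity
  applies. In the chain count this turns a letter weight into its partial sums.\<close>

lemma sum_prod_list_below:
  fixes w :: "nat \<Rightarrow> 'a :: comm_semiring_1"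
  shows "(\<Sum>b | list_all2 (\<le>) b a. prod_list (map w b)) = prod_list (map (\<lambda>k. \<Sum>j\<le>k. w j) a)"
proof (induction a)
  case (Cons x a)
  have "(\<Sum>b | list_all2 (\<le>) b (x # a). prod_list (map w b)) =
    (\<Sum>(j, b)\<in>{..x} \<times> {b. list_all2 (\<le>) b a}. w j * prod_list (map w b))"
    unfolding lists_below_Cons
    by (subst sum.reindex) (auto simp: inj_on_def case_prod_unfold intro!: sum.cong)
  also have "\<dots> = (\<Sum>j\<le>x. w j) * (\<Sum>b | list_all2 (\<le>) b a. prod_list (map w b))"
    by (simp add: sum_product sum.cartesian_product)
  finally show ?case
    by (simp add: Cons.IH)
qed simp

definition chains_below :: "nat \<Rightarrow> nat list \<Rightarrow> nat list list set" where
  "chains_below n a = {es. length es = n \<and> sorted_wrt (list_all2 (\<le>)) (es @ [a])}"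

lemma chains_below_0: "chains_below 0 a = {[]}"
  by (auto simp: chains_below_def)

lemma chains_below_Suc:
  "chains_below (Suc n) a =
    (\<lambda>(b, es). es @ [b]) ` (SIGMA b:{b. list_all2 (\<le>) b a}. chains_below n b)"
proof -
  have trans: "list_all2 (\<le>) b c \<Longrightarrow> list_all2 (\<le>) c d \<Longrightarrow> list_all2 (\<le>) b d" for b c d :: "nat list"
    by (rule list_all2_trans[of "(\<le>)" "(\<le>)" "(\<le>)"]) auto
  have "es \<in> chains_below (Suc n) a \<longleftrightarrow>
      (\<exists>b fs. es = fs @ [b] \<and> list_all2 (\<le>) b a \<and> fs \<in> chains_below n b)" for es
    by (cases es rule: rev_cases) (auto simp: chains_below_def sorted_wrt_append intro: trans)
  then show ?thesis
    by (auto simp: image_iff)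
qed

lemma finite_chains_below: "finite (chains_below n a)"
  by (induction n arbitrary: a)
    (simp_all add: chains_below_0 chains_below_Suc finite_SigmaI finite_lists_below)

lemma inj_on_snoc: "inj_on (\<lambda>(b, es). es @ [b]) A"
  by (auto simp: inj_on_def)

text \<open>Each further entry replaces the letter weight by its partial sums, that is, multiplies
  its generating function by \<open>geometric_fps\<close>. The exponent is \<open>Suc n\<close>
  because the empty chain already gives every letter weight 1.\<close>

lemma card_chains_below:
  "of_nat (card (chains_below n a)) = prod_list (map (\<lambda>k. (geometric_fps ^ Suc n) $ k) a)"
proof (induction n arbitrary: a)
  case 0
  then show ?case
    by (induction a) (simp_all add: chains_below_0)
next
  case (Suc n)
  have "of_nat (card (chains_below (Suc n) a)) =
      (\<Sum>b | list_all2 (\<le>) b a. of_nat (card (chains_below n b)) :: rat)"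
    by (simp add: chains_below_Suc card_image inj_on_snoc card_SigmaI finite_lists_below
        finite_chains_below)
  also have "\<dots> = (\<Sum>b | list_all2 (\<le>) b a. prod_list (map (\<lambda>k. (geometric_fps ^ Suc n) $ k) b))"
    by (simp only: Suc.IH)
  also have "\<dots> = prod_list (map (\<lambda>k. (geometric_fps ^ Suc (Suc n)) $ k) a)"
    unfolding sum_prod_list_below power_Suc[of geometric_fps "Suc n"] geometric_fps_times_nth ..
  finally show ?case .
qed

section \<open>Multichains in the poset as weighted words\<close>

lemma sum_list_le_if_list_all2:
  "list_all2 (\<le>) b a \<Longrightarrow> sum_list b \<le> sum_list a" for a b :: "nat list"
  by (induction rule: list_all2_induct) auto

text \<open>All conditions bound sums of letters from above, and lowering letters can only shrink
  these sums.\<close>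

lemma PF_downward_closed:
  assumes "a \<in> PF m x y" "list_all2 (\<le>) b a"
  shows "b \<in> PF m x y"
proof -
  have "m * sum_list (take j b) < j" if "j \<in> {1..x - 1}" for j
  proof -
    have "m * sum_list (take j b) \<le> m * sum_list (take j a)"
      using assms(2) by (intro mult_le_mono2 sum_list_le_if_list_all2 list_all2_takeI)
    also have "\<dots> < j"
      using assms(1) that by (simp add: PF_def)
    finally show ?thesis .
  qed
  moreover have "sum_list b \<le> y"
    using sum_list_le_if_list_all2[OF assms(2)] assms(1) by (simp add: PF_def)
  ultimately show ?thesis
    using assms(1) list_all2_lengthD[OF assms(2)] by (simp add: PF_def)
qed

lemma multichains_PF:
  "multichains (PF m x y) (PF_le m x y) (Suc n) =
    (\<lambda>(a, es). es @ [a]) ` (SIGMA a:PF m x y. chains_below n a)"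
proof -
  have "es \<in> multichains (PF m x y) (PF_le m x y) (Suc n) \<longleftrightarrow>
      (\<exists>a fs. es = fs @ [a] \<and> a \<in> PF m x y \<and> fs \<in> chains_below n a)" for es
  proof (cases es rule: rev_cases)
    case (snoc fs a)
    have closed: "set fs \<subseteq> PF m x y" if "a \<in> PF m x y" "\<forall>e\<in>set fs. list_all2 (\<le>) e a"
      using that PF_downward_closed by blast
    have "sorted_wrt (\<lambda>e e'. (e, e') \<in> PF_le m x y) fs \<longleftrightarrow> sorted_wrt (list_all2 (\<le>)) fs"
      if "set fs \<subseteq> PF m x y"
      using that by (induction fs) (auto simp: PF_le_def)
    then show ?thesis
      using closed snoc
      by (auto simp: multichains_def chains_below_def sorted_wrt_append PF_le_def)
  qed (simp add: multichains_def)
  then show ?thesis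
    by (auto simp: image_iff)
qed

lemma card_multichains_PF:
  "of_nat (card (multichains (PF m x y) (PF_le m x y) (Suc n))) =
    (\<Sum>a\<in>PF m x y. prod_list (map (\<lambda>k. (geometric_fps ^ Suc n) $ k) a))"
  by (simp add: multichains_PF card_image inj_on_snoc card_SigmaI finite_PF finite_chains_below
      card_chains_below del: power_Suc)

section \<open>Weighted ballot words\<close>

text \<open>The letter sum is fixed exactly so that it can serve as the exponent of
  \<open>t\<close>; a union over \<open>s\<close> recovers \<open>PF\<close>.\<close>

definition ballot_words :: "nat \<Rightarrow> nat \<Rightarrow> nat \<Rightarrow> nat list set" where
  "ballot_words m N s =
    {a. length a = N \<and> (\<forall>j\<in>{1..N}. m * sum_list (take j a) < j) \<and> sum_list a = s}"

lemma ballot_words_0: "ballot_words m 0 s = (if s = 0 then {[]} else {})"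
  by (auto simp: ballot_words_def)

text \<open>Removing the last letter \<open>c\<close> leaves the earlier prefix conditions
  unchanged; the condition on the full word depends on \<open>s\<close> alone and becomes the
  guard.\<close>

lemma ballot_words_Suc:
  "ballot_words m (Suc N) s =
    (if m * s < Suc N then (\<lambda>(c, b). b @ [c]) ` (SIGMA c:{..s}. ballot_words m N (s - c)) else {})"
proof -
  have "a \<in> ballot_words m (Suc N) s \<longleftrightarrow>
      m * s < Suc N \<and> (\<exists>c b. a = b @ [c] \<and> c \<le> s \<and> b \<in> ballot_words m N (s - c))" for a
  proof (cases a rule: rev_cases)
    case (snoc b c)
    have "(\<forall>j\<in>{1..N}. m * sum_list (take j (b @ [c])) < j) \<longleftrightarrow>
        (\<forall>j\<in>{1..N}. m * sum_list (take j b) < j)" if "length b = N"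
      using that by (intro ball_cong) auto
    then show ?thesis
      by (auto simp: snoc ballot_words_def atLeastAtMostSuc_conv)
  qed (auto simp: ballot_words_def)
  then show ?thesis
    by (auto simp: image_iff)
qed

lemma finite_ballot_words: "finite (ballot_words m N s)"
  by (induction N arbitrary: s) (simp_all add: ballot_words_0 ballot_words_Suc)

lemma PF_conv_ballot_words: "PF m x y = (\<Union>s\<le>y. ballot_words m (x - 1) s)"
  by (auto simp: PF_def ballot_words_def)

lemma sum_ballot_words_Suc:
  fixes w :: "nat \<Rightarrow> 'a :: comm_semiring_1"
  assumes "m * s < Suc N"
  shows "(\<Sum>a\<in>ballot_words m (Suc N) s. prod_list (map w a)) =
    (\<Sum>c\<le>s. w c * (\<Sum>b\<in>ballot_words m N (s - c). prod_list (map w b)))"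
proof -
  have "(\<Sum>a\<in>ballot_words m (Suc N) s. prod_list (map w a)) =
      (\<Sum>(c, b)\<in>(SIGMA c:{..s}. ballot_words m N (s - c)). w c * prod_list (map w b))"
    using assms
    by (simp only: ballot_words_Suc if_True sum.reindex[OF inj_on_snoc])
      (simp add: case_prod_unfold mult.commute)
  then show ?thesis
    by (simp add: sum.Sigma finite_ballot_words sum_distrib_left)
qed

text \<open>The series \<open>t A' A^N\<close> is \<open>t (A^(N+1))'\<close> divided by
  \<open>N + 1\<close>, and \<open>t d/dt\<close> multiplies the \<open>s\<close>-th coefficient by
  \<open>s\<close>. So the coefficient in question is \<open>1 - m s / (N + 1)\<close> times that of
  \<open>A^(N+1)\<close>.\<close>

lemma ballot_coeff_eq_0:
  fixes A :: "'a :: field_char_0 fps"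
  assumes "m * s = Suc N"
  shows "(A ^ N * (A - of_nat m * fps_X * fps_deriv A)) $ s = 0"
proof -
  define Q where "Q = (fps_X * (fps_deriv A * A ^ N)) $ s"
  have "s \<noteq> 0"
    using assms by (intro notI) simp
  have "of_nat s * (A ^ Suc N) $ s = (fps_X * fps_deriv (A ^ Suc N)) $ s"
    using \<open>s \<noteq> 0\<close> by (simp add: fps_X_mult_nth del: power_Suc)
  also have "fps_X * fps_deriv (A ^ Suc N) = of_nat (m * s) * (fps_X * (fps_deriv A * A ^ N))"
    unfolding fps_deriv_power' assms by (simp add: mult_ac del: of_nat_Suc power_Suc)
  also have "\<dots> $ s = of_nat s * (of_nat m * Q)"
    unfolding fps_of_nat[symmetric] fps_mult_left_const_nth Q_def[symmetric]
    by (simp add: mult_ac)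
  finally have "(A ^ Suc N) $ s = of_nat m * Q"
    using \<open>s \<noteq> 0\<close> by simp
  moreover have "A ^ N * (A - of_nat m * fps_X * fps_deriv A) =
      A ^ Suc N - fps_const (of_nat m) * (fps_X * (fps_deriv A * A ^ N))"
    by (simp add: algebra_simps fps_of_nat)
  ultimately show ?thesis
    by (simp only: fps_sub_nth fps_mult_left_const_nth Q_def) simp
qed

text \<open>Weighted form of the ballot theorem. The boundary case \<open>m s = Suc N\<close>, where both sides
  vanish, is included so that appending a letter just multiplies the generating function by \<open>A\<close>.\<close>

lemma sum_ballot_words:
  fixes A :: "'a :: field_char_0 fps"
  assumes "A $ 0 = 1" "m \<ge> 1" "m * s \<le> Suc N"
  shows "(\<Sum>a\<in>ballot_words m (Suc N) s. prod_list (map (($) A) a)) =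
    (A ^ N * (A - of_nat m * fps_X * fps_deriv A)) $ s"
  using assms(3)
proof (induction N arbitrary: s)
  case 0
  show ?case
  \<comment> \<open>Here \<open>m * s\<close> is 0 or 1. The value 1 is the boundary, where
    strictness admits no word; the value 0 forces \<open>s = 0\<close>.\<close>
  proof (cases "m * s = Suc 0")
    case True
    then show ?thesis
      using ballot_coeff_eq_0[OF True, of A] by (simp add: ballot_words_Suc)
  next
    case False
    with 0 assms(2) have "s = 0"
      by (cases "m * s") auto
    then show ?thesis
      using assms(1) by (simp add: sum_ballot_words_Suc ballot_words_0 mult.assoc)
  qed
next
  case (Suc N)
  show ?case
  proof (cases "m * s = Suc (Suc N)")
    case True
    then show ?thesis
      using ballot_coeff_eq_0[OF True, of A] by (simp add: ballot_words_Suc)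
  next
    case False
    have "(\<Sum>b\<in>ballot_words m (Suc N) (s - c). prod_list (map (($) A) b)) =
        (A ^ N * (A - of_nat m * fps_X * fps_deriv A)) $ (s - c)" if "c \<le> s" for c
    proof (rule Suc.IH)
      \<comment> \<open>Off the boundary \<open>m * s \<le> Suc N\<close>. Equality may occur for
        \<open>c = 0\<close>, which calls on the boundary case of the induction hypothesis.\<close>
      show "m * (s - c) \<le> Suc N"
        using False Suc.prems by (simp add: diff_mult_distrib2)
    qed
    then have "(\<Sum>a\<in>ballot_words m (Suc (Suc N)) s. prod_list (map (($) A) a)) =
        (\<Sum>c\<le>s. A $ c * (A ^ N * (A - of_nat m * fps_X * fps_deriv A)) $ (s - c))"
      using False Suc.prems by (simp add: sum_ballot_words_Suc)
    also have "\<dots> = (A ^ Suc N * (A - of_nat m * fps_X * fps_deriv A)) $ s"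
      by (simp add: fps_mult_nth[of A] atLeast0AtMost mult.assoc)
    finally show ?thesis .
  qed
qed

section \<open>Evaluation by binomial coefficients\<close>

lemma of_nat_choose_eq_prod:
  "of_nat ((K + y) choose y) = (\<Prod>j=1..y. of_nat K + of_nat j) / (fact y :: 'a :: field_char_0)"
proof (induction y)
  case (Suc y)
  have "(K + Suc y choose Suc y) * Suc y = (K + y choose y) * (K + Suc y)"
    using Suc_times_binomial_eq[of "K + y" y] by (simp add: mult.commute)
  then have "of_nat (K + Suc y choose Suc y) * of_nat (Suc y) =
      (of_nat (K + y choose y) * of_nat (K + Suc y) :: 'a)"
    by (metis of_nat_mult)
  then have "of_nat (K + Suc y choose Suc y) =
      (of_nat (K + y choose y) * of_nat (K + Suc y) / of_nat (Suc y) :: 'a)"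
    by (simp add: eq_divide_eq del: of_nat_Suc binomial_Suc_Suc of_nat_mult)
  then show ?case
    by (simp add: Suc.IH add_ac mult_ac del: binomial_Suc_Suc)
qed simp

text \<open>For \<open>A = geometric_fps ^ Suc n\<close> the derivative is \<open>Suc n\<close>
  times \<open>geometric_fps * A\<close>, so the weighted ballot series reduces to powers of
  \<open>geometric_fps\<close>. One more such factor sums over the letter sums up to
  \<open>y\<close>, raising both exponents by one.\<close>

lemma card_multichains_PF_eq_coeff:
  assumes "m \<ge> 1" "m * y \<le> Suc N" and K_def: "K = Suc N * Suc n"
  shows "of_nat (card (multichains (PF m (Suc (Suc N)) y) (PF_le m (Suc (Suc N)) y) (Suc n))) =
    (geometric_fps ^ Suc K -
      fps_const (of_nat (m * Suc n)) * (fps_X * geometric_fps ^ Suc (Suc K))) $ y"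
proof -
  define A where "A = geometric_fps ^ Suc n"
  have A_power: "A ^ Suc N = geometric_fps ^ K"
    by (simp add: A_def K_def power_mult[symmetric] mult.commute del: power_Suc mult_Suc mult_Suc_right)
  have deriv_A: "fps_deriv A = of_nat (Suc n) * (geometric_fps * A)"
    unfolding A_def fps_deriv_power' fps_deriv_geometric
    by (simp add: power2_eq_square mult_ac del: of_nat_Suc)
  have "A ^ N * (A - of_nat m * fps_X * fps_deriv A) =
      A ^ Suc N - of_nat (m * Suc n) * (fps_X * (geometric_fps * A ^ Suc N))"
    unfolding deriv_A of_nat_mult power_Suc right_diff_distrib by (simp only: mult_ac)
  then have G: "A ^ N * (A - of_nat m * fps_X * fps_deriv A) =
      geometric_fps ^ K - fps_const (of_nat (m * Suc n)) * (fps_X * geometric_fps ^ Suc K)"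
    unfolding A_power by (simp only: fps_of_nat power_Suc)
  have "of_nat (card (multichains (PF m (Suc (Suc N)) y) (PF_le m (Suc (Suc N)) y) (Suc n))) =
      (\<Sum>a\<in>(\<Union>s\<le>y. ballot_words m (Suc N) s). prod_list (map (($) A) a))"
    unfolding card_multichains_PF by (simp add: PF_conv_ballot_words A_def del: power_Suc)
  also have "\<dots> = (\<Sum>s\<le>y. \<Sum>a\<in>ballot_words m (Suc N) s. prod_list (map (($) A) a))"
    by (intro sum.UNION_disjoint) (auto simp: finite_ballot_words, auto simp: ballot_words_def)
  also have "\<dots> = (\<Sum>s\<le>y. (A ^ N * (A - of_nat m * fps_X * fps_deriv A)) $ s)"
  proof (intro sum.cong sum_ballot_words)
    fix s assume "s \<in> {..y}"
    then have "m * s \<le> m * y"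
      by simp
    then show "m * s \<le> Suc N"
      using assms(2) by (rule order_trans)
  qed (use assms(1) in \<open>simp_all add: A_def del: power_Suc\<close>)
  also have "\<dots> = (geometric_fps * (A ^ N * (A - of_nat m * fps_X * fps_deriv A))) $ y"
    by (rule geometric_fps_times_nth[symmetric])
  finally show ?thesis
    unfolding G by (simp add: algebra_simps)
qed

text \<open>Both binomial coefficients contain the same product \<open>P\<close> over
  \<open>fact (Suc z)\<close>, with cofactors \<open>K + 1\<close> and \<open>Suc z\<close>. The
  linear factor of the formula is \<open>K + 1 - m * Suc n * Suc z\<close>.\<close>

lemma card_multichains_PF_Suc:
  assumes "m \<ge> 1" "m * Suc z \<le> k"
  shows "of_nat (card (multichains (PF m (Suc k) (Suc z)) (PF_le m (Suc k) (Suc z)) (Suc n))) =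
    ((of_nat k - of_nat m * of_nat (Suc z)) * of_nat (Suc n) + 1) / fact (Suc z) *
      (\<Prod>j=2..Suc z. of_nat k * of_nat (Suc n) + of_nat j :: rat)"
proof -
  obtain N where N: "k = Suc N"
    using assms by (cases k) auto
  define K where "K = k * Suc n"
  define P :: rat where "P = (\<Prod>j=2..Suc z. of_nat K + of_nat j)"
  have P: "P = (\<Prod>j=2..Suc z. of_nat k * of_nat (Suc n) + of_nat j)"
    by (simp only: P_def K_def of_nat_mult)
  have alg: "(k * n + 1) * P / f - m * n * (z * P / f) = ((k - m * z) * n + 1) / f * P"
    for k n m z f :: rat
    by (simp add: algebra_simps add_divide_distrib diff_divide_distrib)
  have "of_nat (K + Suc z choose Suc z) = (of_nat K + 1) * P / fact (Suc z)"
    unfolding of_nat_choose_eq_prod P_def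
    by (subst prod.atLeast_Suc_atMost) (simp_all add: numeral_2_eq_2)
  moreover have "of_nat (Suc K + z choose z) = of_nat (Suc z) * P / fact (Suc z)"
  proof -
    \<comment> \<open>Shifting the index by one moves the successor from \<open>K\<close> to
      \<open>j\<close>.\<close>
    have "(\<Prod>j=1..z. of_nat (Suc K) + of_nat j) = P"
      unfolding P_def numeral_2_eq_2 prod.shift_bounds_cl_Suc_ivl by (simp add: add_ac)
    then show ?thesis
      by (simp only: of_nat_choose_eq_prod fact_Suc) simp
  qed
  moreover have "of_nat (card (multichains (PF m (Suc k) (Suc z)) (PF_le m (Suc k) (Suc z)) (Suc n))) =
      (of_nat (K + Suc z choose Suc z) - of_nat (m * Suc n) * of_nat (Suc K + z choose z) :: rat)"
    using card_multichains_PF_eq_coeff[of m "Suc z" N _ n, OF _ _ refl] assms N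
    by (simp only: fps_sub_nth fps_mult_left_const_nth fps_X_mult_nth geometric_fps_power_nth
        K_def) simp
  ultimately show ?thesis
    unfolding P[symmetric] by (simp only: alg K_def of_nat_mult)
qed

text \<open>The coefficient formula reduces to the constant term of a power of
  \<open>geometric_fps\<close>. It presupposes at least one letter, so the empty word,
  \<open>k = 0\<close>, is treated directly.\<close>

lemma card_multichains_PF_0:
  assumes "m \<ge> 1"
  shows "card (multichains (PF m (Suc k) 0) (PF_le m (Suc k) 0) (Suc n)) = 1"
proof (cases k)
  case 0
  then have "PF m (Suc k) 0 = {[]}"
    by (auto simp: PF_def)
  then have "of_nat (card (multichains (PF m (Suc k) 0) (PF_le m (Suc k) 0) (Suc n))) = (1 :: rat)"
    unfolding card_multichains_PF by simp
  then show ?thesis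
    by simp
next
  case (Suc N)
  have "of_nat (card (multichains (PF m (Suc k) 0) (PF_le m (Suc k) 0) (Suc n))) = (1 :: rat)"
    unfolding Suc
    by (subst card_multichains_PF_eq_coeff[OF _ _ refl]) (use assms in \<open>simp_all del: power_Suc\<close>)
  then show ?thesis
    by simp
qed

section \<open>The zeta polynomial and its image among rational functions\<close>

lemma to_fract_of_nat: "to_fract (of_nat n) = of_nat n"
  by (induction n) simp_all

lemma to_fract_prod: "to_fract (prod f A) = (\<Prod>x\<in>A. to_fract (f x))"
  by (induction A rule: infinite_finite_induct) simp_all

text \<open>For \<open>y = 0\<close> the linear factor of \<open>ZF\<close> cancels against the
  conventional denominator, leaving the constant 1.\<close>

definition PF_zeta_poly :: "nat \<Rightarrow> nat \<Rightarrow> nat \<Rightarrow> rat poly" where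
  "PF_zeta_poly m x y =
    (if y = 0 then 1 else
      smult (1 / fact y)
        (((of_nat x - of_nat m * of_nat y - 1) * ([:0, 1:] - 1) + 1) *
          (\<Prod>j=2..y. (of_nat x - 1) * ([:0, 1:] - 1) + of_nat j)))"

lemma is_zeta_polynomial_PF:
  assumes "m \<ge> 1" "m * y < x"
  shows "is_zeta_polynomial (PF m x y) (PF_le m x y) (PF_zeta_poly m x y)"
  unfolding is_zeta_polynomial_def
proof (intro allI impI)
  fix q :: nat
  assume "q \<ge> 2"
  then obtain n where q: "q = Suc (Suc n)"
    by (metis add_2_eq_Suc le_Suc_ex)
  obtain k where x: "x = Suc k"
    using assms(2) by (cases x) auto
  show "poly (PF_zeta_poly m x y) (of_nat q) =
      of_nat (card (multichains (PF m x y) (PF_le m x y) (q - 1)))"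
  proof (cases y)
    case 0
    then show ?thesis
      using card_multichains_PF_0[OF assms(1), of k n] by (simp add: PF_zeta_poly_def x q)
  next
    case (Suc z)
    have "m * y \<le> k"
      using assms(2) x by simp
    have "poly (PF_zeta_poly m x y) u =
        ((of_nat x - of_nat m * of_nat y - 1) * (u - 1) + 1) / fact y *
          (\<Prod>j=2..y. (of_nat x - 1) * (u - 1) + of_nat j)" for u
      using Suc by (simp add: PF_zeta_poly_def poly_prod del: prod.cl_ivl_Suc)
    moreover have "of_nat q - 1 = (of_nat (Suc n) :: rat)" "of_nat x - 1 = (of_nat k :: rat)"
      "of_nat x - of_nat m * of_nat y - 1 = (of_nat k - of_nat m * of_nat y :: rat)"
      by (simp_all add: q x)
    ultimately show ?thesis
      using card_multichains_PF_Suc[of m z k n] assms(1) \<open>m * y \<le> k\<close>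
      by (simp only: Suc[symmetric] x[symmetric]) (simp add: q)
  qed
qed

lemma to_fract_PF_zeta_poly:
  assumes "m * y < x"
  shows "to_fract (PF_zeta_poly m x y) = ZF m x y"
proof (cases "y = 0")
  case True
  define D :: "rat poly" where "D = (of_nat x - 1) * ([:0, 1:] - 1) + 1"
  \<comment> \<open>One nonzero value makes \<open>D\<close> a nonzero polynomial, hence invertible
    in the fraction field.\<close>
  have "poly D 1 = 1"
    by (simp add: D_def)
  then have "D \<noteq> 0"
    by auto
  then have "to_fract D \<noteq> 0"
    by simp
  then have "(of_nat x - 1) * (indet - 1) + 1 \<noteq> 0"
    by (simp add: D_def indet_def to_fract_of_nat)
  then show ?thesis
    using True by (simp add: PF_zeta_poly_def ZF_def prod_from_2_def)
next
  case False
  define Q :: "rat poly" where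
    "Q = ((of_nat x - of_nat m * of_nat y - 1) * ([:0, 1:] - 1) + 1) *
      (\<Prod>j=2..y. (of_nat x - 1) * ([:0, 1:] - 1) + of_nat j)"
  \<comment> \<open>Clearing the factorial leaves a natural-number scalar, which
    \<open>to_fract\<close> preserves, in place of the rational scalar
    \<open>1 / fact y\<close>.\<close>
  have "of_nat (fact y) * PF_zeta_poly m x y = Q"
    using False by (simp add: PF_zeta_poly_def Q_def of_nat_poly)
  then have "of_nat (fact y) * to_fract (PF_zeta_poly m x y) = to_fract Q"
    by (metis to_fract_mult to_fract_of_nat)
  then have "fact y * to_fract (PF_zeta_poly m x y) = to_fract Q"
    by simp
  moreover have "to_fract Q = fact y * ZF m x y"
    using False by (simp add: Q_def ZF_def prod_from_2_def indet_def to_fract_of_nat to_fract_prod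
        Let_def)
  ultimately show ?thesis
    by simp
qed

theorem theorem6p2:
  fixes m x y :: nat
  assumes "m \<ge> 1" and "m * y < x"
  shows "\<exists>Z. is_zeta_polynomial (PF m x y) (PF_le m x y) Z \<and> to_fract Z = ZF m x y"
  using is_zeta_polynomial_PF[OF assms] to_fract_PF_zeta_poly[OF assms(2)] by blast

end
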